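(* Let $\mathbf{x}_1,\dots,\mathbf{x}_m\in\mathbb{R}^n$, $\mathbf{y}\in\{-1,1\}^m$, $0<c<C$ and $s\in\{1,\dots,m\}$. Consider the problem $$\min_{\boldsymbol\alpha\in\mathbb{R}^m} D(\boldsymbol\alpha)\quad\text{s.t.}\quad \langle\boldsymbol\alpha,\mathbf{y}\rangle=0,\ \ \|\boldsymbol\alpha\|_0\le s ,$$ and let $\boldsymbol\alpha^*$ be a feasible point, namely $\|\boldsymbol\alpha^*\|_0\le s$ and $\langle\boldsymbol\alpha^*,\mathbf{y}\rangle=0$. Then the following hold. i) For local minimizers and $\eta$-stationary points: a) If $\boldsymbol\alpha^*$ is an $\eta$-stationary point (for some $\eta>0$), then it is also a local minimizer. b) If $\boldsymbol\alpha^*$ is a local minimizer, then it is an $\eta$-stationary point: for any $\eta>0$ if $\|\boldsymbol\alpha^*\|_0<s$; and for any $0<\eta\le\eta^*$ if $\|\boldsymbol\alpha^*\|_0=s$, where $\eta^*>0$ is a constant depending on $\boldsymbol\alpha^*$. ii) For global minimizers and $\eta$-stationary points: c) If $\|\boldsymbol\alpha^*\|_0<s$, then the local minimizer, the global minimizer and the $\eta$-stationary point are identical to each other and unique (that is, for such $\boldsymbol\alpha^*$, being a local minimizer, being a global minimizer and being an $\eta$-stationary point are equivalent, and in that case $\boldsymbol\alpha^*$ is the unique global minimizer). d) If $\|\boldsymbol\alpha^*\|_0=s$ and $\boldsymbol\alpha^*$ is an $\eta$-stationary point with $\eta\ge C$, then it is also a global minimizer. Moreover, it is the unique global minimizer if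 $\eta>C$.
   Context: $D(\boldsymbol\alpha)=\frac12\|Q\boldsymbol\alpha\|^2+\frac12\langle E(\boldsymbol\alpha)\boldsymbol\alpha,\boldsymbol\alpha\rangle-\langle\mathbf{1},\boldsymbol\alpha\rangle$, where $Q:=[y_1\mathbf{x}_1\ \cdots\ y_m\mathbf{x}_m]\in\mathbb{R}^{n\times m}$, $\mathbf{1}$ is the all-ones vector, and $E(\boldsymbol\alpha)$ is the diagonal matrix with $E_{ii}(\boldsymbol\alpha)=1/C$ if $\alpha_i\ge0$, $1/c$ if $\alpha_i<0$. $H(\boldsymbol\alpha):=Q^\top Q+E(\boldsymbol\alpha)$, and for $\mathbf{z}=(\boldsymbol\alpha;b)\in\mathbb{R}^m\times\mathbb{R}$, $g(\mathbf{z}):=H(\boldsymbol\alpha)\boldsymbol\alpha-\mathbf{1}+b\,\mathbf{y}$ (that is, $\nabla D(\boldsymbol\alpha)+b\,\mathbf{y}$). $\|\boldsymbol\alpha\|_0$ is the number of nonzero entries. $\mathbb{P}_s(\boldsymbol\alpha):=\operatorname{argmin}_{\mathbf{u}}\{\|\mathbf{u}-\boldsymbol\alpha\|:\|\mathbf{u}\|_0\le s\}$ (a set of minimizers). For $\eta>0$, $\boldsymbol\alpha^*$ is an $\eta$-stationary point of the problem if there is $b^*\in\mathbb{R}$ such that, with $\mathbf{z}^*=(\boldsymbol\alpha^*;b^* )$, $\boldsymbol\alpha^*\in\mathbb{P}_s\big[\boldsymbol\alpha^*-\eta g(\mathbf{z}^* )\big]$ and $\langle\boldsymbol\alpha^*,\mathbf{y}\rangle=0$.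 Local and global minimizers are with respect to the feasible set of the problem.
   Formalization: When s = 1 and y has both signs, α* = 0 is the only feasible point, hence the minimizer, but never η-stationary; so b) for ‖α*‖₀ < s and the η-stationarity equivalence in c) assume that y is constant if s = 1. *)

theory Defs
  imports "HOL-Analysis.Analysis"
begin

definition l0norm :: "real ^ 'm \<Rightarrow> nat" where
  "l0norm \<alpha> = card {i. \<alpha> $ i \<noteq> 0}"

text \<open>The data vectors are \<open>x i\<close>, with \<open>i\<close> ranging over an index type of cardinality \<open>m\<close>;
  column \<open>i\<close> of \<open>Qmat x y\<close> is \<open>(y $ i) *\<^sub>R x i\<close>.\<close>

definition Qmat :: "('m \<Rightarrow> real ^ 'n) \<Rightarrow> real ^ 'm \<Rightarrow> real ^ 'm ^ 'n" where
  "Qmat x y = (\<chi> k i. y $ i * x i $ k)"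

definition Emat :: "real \<Rightarrow> real \<Rightarrow> real ^ 'm \<Rightarrow> real ^ 'm ^ 'm" where
  "Emat C c \<alpha> = (\<chi> i j. if i = j then (if \<alpha> $ i \<ge> 0 then 1 / C else 1 / c) else 0)"

definition Hmat ::
  "('m::finite \<Rightarrow> real ^ 'n) \<Rightarrow> real ^ 'm \<Rightarrow> real \<Rightarrow> real \<Rightarrow> real ^ 'm \<Rightarrow> real ^ 'm ^ 'm" where
  "Hmat x y C c \<alpha> = transpose (Qmat x y) ** Qmat x y + Emat C c \<alpha>"

definition dual_obj ::
  "('m::finite \<Rightarrow> real ^ 'n) \<Rightarrow> real ^ 'm \<Rightarrow> real \<Rightarrow> real \<Rightarrow> real ^ 'm \<Rightarrow> real" where
  "dual_obj x y C c \<alpha> =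
     1 / 2 * (norm (Qmat x y *v \<alpha>))\<^sup>2 + 1 / 2 * ((Emat C c \<alpha> *v \<alpha>) \<bullet> \<alpha>) - vec 1 \<bullet> \<alpha>"

definition gmap ::
  "('m::finite \<Rightarrow> real ^ 'n) \<Rightarrow> real ^ 'm \<Rightarrow> real \<Rightarrow> real \<Rightarrow> (real ^ 'm) \<times> real \<Rightarrow> real ^ 'm" where
  "gmap x y C c = (\<lambda>(\<alpha>, b). Hmat x y C c \<alpha> *v \<alpha> - vec 1 + b *\<^sub>R y)"

definition sparse_proj :: "nat \<Rightarrow> real ^ 'm \<Rightarrow> (real ^ 'm) set" where
  "sparse_proj s \<alpha> = {u. is_arg_min (\<lambda>u. norm (u - \<alpha>)) (\<lambda>u. l0norm u \<le> s) u}"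

definition feasible :: "real ^ 'm \<Rightarrow> nat \<Rightarrow> real ^ 'm \<Rightarrow> bool" where
  "feasible y s \<alpha> \<longleftrightarrow> \<alpha> \<bullet> y = 0 \<and> l0norm \<alpha> \<le> s"

definition eta_stationary ::
  "('m::finite \<Rightarrow> real ^ 'n) \<Rightarrow> real ^ 'm \<Rightarrow> real \<Rightarrow> real \<Rightarrow> nat \<Rightarrow> real \<Rightarrow> real ^ 'm \<Rightarrow> bool" where
  "eta_stationary x y C c s \<eta> \<alpha> \<longleftrightarrow>
     (\<exists>b. \<alpha> \<in> sparse_proj s (\<alpha> - \<eta> *\<^sub>R gmap x y C c (\<alpha>, b)) \<and> \<alpha> \<bullet> y = 0)"

definition global_minimizer ::
  "('m::finite \<Rightarrow> real ^ 'n) \<Rightarrow> real ^ 'm \<Rightarrow> real \<Rightarrow> real \<Rightarrow> nat \<Rightarrow> real ^ 'm \<Rightarrow> bool" where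
  "global_minimizer x y C c s \<alpha> \<longleftrightarrow> is_arg_min (dual_obj x y C c) (feasible y s) \<alpha>"

definition local_minimizer ::
  "('m::finite \<Rightarrow> real ^ 'n) \<Rightarrow> real ^ 'm \<Rightarrow> real \<Rightarrow> real \<Rightarrow> nat \<Rightarrow> real ^ 'm \<Rightarrow> bool" where
  "local_minimizer x y C c s \<alpha> \<longleftrightarrow>
     (\<exists>\<epsilon>>0. is_arg_min (dual_obj x y C c) (\<lambda>\<beta>. feasible y s \<beta> \<and> dist \<beta> \<alpha> < \<epsilon>) \<alpha>)"

definition unique_global_minimizer ::
  "('m::finite \<Rightarrow> real ^ 'n) \<Rightarrow> real ^ 'm \<Rightarrow> real \<Rightarrow> real \<Rightarrow> nat \<Rightarrow> real ^ 'm \<Rightarrow> bool" where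
  "unique_global_minimizer x y C c s \<alpha> \<longleftrightarrow>
     global_minimizer x y C c s \<alpha> \<and> (\<forall>\<beta>. global_minimizer x y C c s \<beta> \<longrightarrow> \<beta> = \<alpha>)"

text \<open>Excludes the degenerate instance \<open>s = 1\<close> with labels of both signs.  There \<open>0\<close> is the only
  feasible point, hence a minimizer with fewer than \<open>s\<close> nonzero entries, but it is not
  \<open>\<eta>\<close>-stationary for any \<open>\<eta> > 0\<close>: that would require \<open>b *\<^sub>R y = vec 1\<close> for some \<open>b\<close>.\<close>

definition nondegenerate :: "real ^ 'm \<Rightarrow> nat \<Rightarrow> bool" where
  "nondegenerate y s \<longleftrightarrow> (s = 1 \<longrightarrow> (\<forall>i j. y $ i = y $ j))"

end

theory Submission
  imports Defs
begin

text \<open>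
  \<open>D\<close> lies above its tangent at \<open>\<alpha>\<close> by at least \<open>\<parallel>\<beta> - \<alpha>\<parallel>\<^sup>2 / (2 C)\<close>, and by at most a
  multiple of \<open>\<parallel>\<beta> - \<alpha>\<parallel>\<^sup>2\<close>. On the hyperplane \<open>\<beta> \<bullet> y = 0\<close> the gradient may be replaced by
  \<open>g = \<nabla>D + b y\<close>. For \<open>\<eta> \<ge> C\<close> the lower bound dominates
  \<open>g \<bullet> (\<beta> - \<alpha>) + \<parallel>\<beta> - \<alpha>\<parallel>\<^sup>2 / (2 \<eta>) = (\<parallel>\<beta> - (\<alpha> - \<eta> g)\<parallel>\<^sup>2 - \<parallel>\<eta> g\<parallel>\<^sup>2) / (2 \<eta>)\<close>, which is
  nonnegative by stationarity. In general, stationarity makes \<open>g\<close> vanish in every coordinate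
  that can be added to the support of \<open>\<alpha>\<close> without exceeding \<open>s\<close> nonzero entries, and near \<open>\<alpha>\<close>
  the support can only grow. Conversely, moving a local minimizer along
  \<open>y\<^sub>i e\<^sub>i - y\<^sub>j e\<^sub>j\<close> shows that \<open>y\<^sub>i \<nabla>\<^sub>i D\<close> is the same number, namely \<open>- b\<close>, for all these
  coordinates.\<close>

section \<open>Gradient of the objective and its two-sided quadratic bounds\<close>

definition grad :: "('m::finite \<Rightarrow> real ^ 'n) \<Rightarrow> real ^ 'm \<Rightarrow> real \<Rightarrow> real \<Rightarrow> real ^ 'm \<Rightarrow> real ^ 'm" where
  "grad x y C c \<alpha> = Hmat x y C c \<alpha> *v \<alpha> - vec 1"

lemma gmap_eq: "gmap x y C c (\<alpha>, b) = grad x y C c \<alpha> + b *\<^sub>R y"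
  by (simp add: gmap_def grad_def)

text \<open>The diagonal of \<open>Emat\<close> as a function of one coordinate. It jumps at 0, yet
  \<open>penalty_slope C c t * t\<close> is continuous in \<open>t\<close>, being the derivative of
  the piecewise quadratic \<open>penalty_slope C c t * t\<^sup>2 / 2\<close>.\<close>

definition penalty_slope :: "real \<Rightarrow> real \<Rightarrow> real \<Rightarrow> real" where
  "penalty_slope C c t = (if t \<ge> 0 then 1 / C else 1 / c)"

lemma Emat_mult_nth: "(Emat C c \<alpha> *v \<beta>) $ i = penalty_slope C c (\<alpha> $ i) * \<beta> $ i"
proof -
  have "Emat C c \<alpha> $ i $ j * \<beta> $ j = (if j = i then penalty_slope C c (\<alpha> $ i) * \<beta> $ i else 0)" for j
    by (simp add: Emat_def penalty_slope_def)
  then show ?thesis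
    by (simp add: matrix_vector_mult_def)
qed

lemma grad_inner:
  "grad x y C c \<alpha> \<bullet> d =
     (Qmat x y *v \<alpha>) \<bullet> (Qmat x y *v d) + (Emat C c \<alpha> *v \<alpha>) \<bullet> d - vec 1 \<bullet> d"
  by (simp add: grad_def Hmat_def matrix_vector_mult_add_rdistrib inner_diff_left inner_add_left
      matrix_vector_mul_assoc [symmetric] dot_lmul_matrix)

text \<open>The Bregman divergence of this piecewise quadratic: its value at \<open>b\<close> minus
  the tangent taken at \<open>a\<close>.\<close>

definition penalty_gap :: "real \<Rightarrow> real \<Rightarrow> real \<Rightarrow> real \<Rightarrow> real" where
  "penalty_gap C c a b = penalty_slope C c b * b\<^sup>2 / 2 - penalty_slope C c a * a\<^sup>2 / 2
     - penalty_slope C c a * a * (b - a)"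

text \<open>The derivative of the penalty is piecewise linear with slopes 1/C and 1/c, so the
  penalty is 1/C-strongly convex and 1/c-smooth. The four sign patterns are settled by explicit
  identities.\<close>

lemma penalty_gap_bounds:
  assumes "0 < c" "c < C"
  shows "(b - a)\<^sup>2 / (2 * C) \<le> penalty_gap C c a b" "penalty_gap C c a b \<le> (b - a)\<^sup>2 / (2 * c)"
proof -
  define p q where "p = 1 / C" and "q = 1 / c"
  have pq: "p < q" "0 < p" using assms by (auto simp: p_def q_def frac_less2)
  have "p * (b - a)\<^sup>2 / 2 \<le> penalty_gap C c a b \<and> penalty_gap C c a b \<le> q * (b - a)\<^sup>2 / 2"
  proof (cases "a \<ge> 0"; cases "b \<ge> 0")
    assume "a \<ge> 0" "b \<ge> 0"
    then have "penalty_gap C c a b = p * (b - a)\<^sup>2 / 2"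
      by (simp add: penalty_gap_def penalty_slope_def p_def [symmetric] power2_eq_square field_simps)
    moreover have "p * (b - a)\<^sup>2 \<le> q * (b - a)\<^sup>2"
      using pq by (simp add: mult_right_mono)
    ultimately show ?thesis by simp
  next
    assume ab: "a \<ge> 0" "\<not> b \<ge> 0"
    \<comment> \<open>Across the kink the gap differs from each bounding parabola by a term whose
      sign is determined by the signs of \<open>a\<close> and \<open>b\<close>.\<close>
    then have e: "penalty_gap C c a b = p * (b - a)\<^sup>2 / 2 + (q - p) * b\<^sup>2 / 2"
      "penalty_gap C c a b = q * (b - a)\<^sup>2 / 2 - (q - p) * (a * (a - 2 * b)) / 2"
      by (simp_all add: penalty_gap_def penalty_slope_def p_def [symmetric] q_def [symmetric]
          power2_eq_square field_simps)
    have "0 \<le> (q - p) * b\<^sup>2" "0 \<le> (q - p) * (a * (a - 2 * b))"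
      using pq ab by (auto intro!: mult_nonneg_nonneg)
    with e show ?thesis by linarith
  next
    assume ab: "\<not> a \<ge> 0" "b \<ge> 0"
    then have e: "penalty_gap C c a b = p * (b - a)\<^sup>2 / 2 + (q - p) * (a * (a - 2 * b)) / 2"
      "penalty_gap C c a b = q * (b - a)\<^sup>2 / 2 - (q - p) * b\<^sup>2 / 2"
      by (simp_all add: penalty_gap_def penalty_slope_def p_def [symmetric] q_def [symmetric]
          power2_eq_square field_simps)
    have "0 \<le> a * (a - 2 * b)"
      using ab by (intro mult_nonpos_nonpos) auto
    then have "0 \<le> (q - p) * b\<^sup>2" "0 \<le> (q - p) * (a * (a - 2 * b))"
      using pq by (auto intro!: mult_nonneg_nonneg)
    with e show ?thesis by linarith
  next
    assume "\<not> a \<ge> 0" "\<not> b \<ge> 0"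
    then have "penalty_gap C c a b = q * (b - a)\<^sup>2 / 2"
      by (simp add: penalty_gap_def penalty_slope_def q_def [symmetric] power2_eq_square field_simps)
    moreover have "p * (b - a)\<^sup>2 \<le> q * (b - a)\<^sup>2"
      using pq by (simp add: mult_right_mono)
    ultimately show ?thesis by simp
  qed
  then show "(b - a)\<^sup>2 / (2 * C) \<le> penalty_gap C c a b" "penalty_gap C c a b \<le> (b - a)\<^sup>2 / (2 * c)"
    by (simp_all add: p_def q_def mult.commute)
qed

lemma norm_power2_vec: "(norm (v :: real ^ 'm::finite))\<^sup>2 = (\<Sum>i\<in>UNIV. (v $ i)\<^sup>2)"
  unfolding power2_norm_eq_inner inner_vec_def by (simp add: power2_eq_square)

text \<open>The least-squares and linear terms expand exactly, so everything beyond a quadratic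
  comes from the separable penalty, coordinate by coordinate.\<close>

lemma dual_obj_expansion:
  "dual_obj x y C c (\<alpha> + d) = dual_obj x y C c \<alpha> + grad x y C c \<alpha> \<bullet> d
     + (norm (Qmat x y *v d))\<^sup>2 / 2 + (\<Sum>i\<in>UNIV. penalty_gap C c (\<alpha> $ i) ((\<alpha> + d) $ i))"
proof -
  let ?e = "\<lambda>v. \<Sum>i\<in>UNIV. penalty_slope C c (v $ i) * (v $ i)\<^sup>2"
  have E: "(Emat C c v *v v) \<bullet> v = ?e v" for v :: "real ^ 'a"
    by (simp add: inner_vec_def Emat_mult_nth power2_eq_square mult.assoc)
  have "(\<Sum>i\<in>UNIV. penalty_gap C c (\<alpha> $ i) ((\<alpha> + d) $ i))
      = ?e (\<alpha> + d) / 2 - ?e \<alpha> / 2 - (Emat C c \<alpha> *v \<alpha>) \<bullet> d"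
    by (simp add: penalty_gap_def sum_subtractf sum_divide_distrib inner_vec_def Emat_mult_nth)
  moreover have "(norm (Qmat x y *v (\<alpha> + d)))\<^sup>2
      = (norm (Qmat x y *v \<alpha>))\<^sup>2 + 2 * ((Qmat x y *v \<alpha>) \<bullet> (Qmat x y *v d))
        + (norm (Qmat x y *v d))\<^sup>2"
    by (simp add: power2_norm_eq_inner matrix_vector_right_distrib inner_add inner_commute)
  ultimately show ?thesis
    unfolding dual_obj_def E grad_inner inner_add_right [of "vec 1"] by argo
qed

text \<open>Strong convexity is drawn from the penalty alone: the \<open>Qmat\<close> term may
  vanish along some directions and is only bounded below by 0.\<close>

lemma dual_obj_lower:
  assumes "0 < c" "c < C"
  shows "dual_obj x y C c \<alpha> + grad x y C c \<alpha> \<bullet> (\<beta> - \<alpha>) + (norm (\<beta> - \<alpha>))\<^sup>2 / (2 * C)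
    \<le> dual_obj x y C c \<beta>"
proof -
  have "(norm (\<beta> - \<alpha>))\<^sup>2 / (2 * C) \<le> (\<Sum>i\<in>UNIV. penalty_gap C c (\<alpha> $ i) (\<beta> $ i))"
    unfolding norm_power2_vec sum_divide_distrib
    by (rule sum_mono) (simp add: penalty_gap_bounds assms)
  moreover have "0 \<le> (norm (Qmat x y *v (\<beta> - \<alpha>)))\<^sup>2 / 2"
    by simp
  moreover have "dual_obj x y C c \<beta> = dual_obj x y C c \<alpha> + grad x y C c \<alpha> \<bullet> (\<beta> - \<alpha>)
      + (norm (Qmat x y *v (\<beta> - \<alpha>)))\<^sup>2 / 2 + (\<Sum>i\<in>UNIV. penalty_gap C c (\<alpha> $ i) (\<beta> $ i))"
    using dual_obj_expansion [of x y C c \<alpha> "\<beta> - \<alpha>"] by simp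
  ultimately show ?thesis
    by linarith
qed

text \<open>Keeping \<open>t\<close> apart from \<open>d\<close> bounds the objective on a line by a
  polynomial in \<open>t\<close> with slope \<open>grad x y C c \<alpha> \<bullet> d\<close> at 0,
  as needed for first-order conditions.\<close>

lemma dual_obj_upper:
  assumes "0 < c" "c < C"
  shows "dual_obj x y C c (\<alpha> + t *\<^sub>R d) \<le> dual_obj x y C c \<alpha> + t * (grad x y C c \<alpha> \<bullet> d)
    + t\<^sup>2 * ((norm (Qmat x y *v d))\<^sup>2 / 2 + (norm d)\<^sup>2 / (2 * c))"
proof -
  have "(\<Sum>i\<in>UNIV. penalty_gap C c (\<alpha> $ i) ((\<alpha> + t *\<^sub>R d) $ i)) \<le> (norm (t *\<^sub>R d))\<^sup>2 / (2 * c)"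
    unfolding norm_power2_vec sum_divide_distrib
    by (rule sum_mono, rule order_trans [OF penalty_gap_bounds(2) [OF assms]]) simp
  moreover have "Qmat x y *v (t *\<^sub>R d) = t *\<^sub>R (Qmat x y *v d)"
    by (simp add: matrix_vector_mult_scaleR)
  ultimately show ?thesis
    using dual_obj_expansion [of x y C c \<alpha> "t *\<^sub>R d"]
    by (simp add: power_mult_distrib field_simps)
qed

lemma dual_obj_lower_gmap:
  assumes "0 < c" "c < C" "\<alpha> \<bullet> y = 0" "\<beta> \<bullet> y = 0"
  shows "dual_obj x y C c \<alpha> + gmap x y C c (\<alpha>, b) \<bullet> (\<beta> - \<alpha>) + (norm (\<beta> - \<alpha>))\<^sup>2 / (2 * C)
    \<le> dual_obj x y C c \<beta>"
proof -
  have "y \<bullet> (\<beta> - \<alpha>) = 0"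
    using assms by (simp add: inner_diff_right inner_commute)
  then show ?thesis
    using dual_obj_lower [OF assms(1,2), of x y \<alpha> \<beta>]
    by (simp add: gmap_eq inner_add_left)
qed

section \<open>Projection onto sparse vectors\<close>

lemma l0norm_le:
  assumes "{i. u $ i \<noteq> 0} \<subseteq> A" "card A \<le> s"
  shows "l0norm (u :: real ^ 'm::finite) \<le> s"
  unfolding l0norm_def using card_mono [OF _ assms(1)] assms(2) by (meson finite order_trans)

text \<open>Replacing coordinate \<open>j\<close> of \<alpha> by that of the projected point keeps
  at most \<open>s\<close> nonzero entries and lowers the squared distance by
  \<open>(\<eta> * g $ j)\<^sup>2\<close>, which optimality of \<alpha> forces to be 0.\<close>

lemma sparse_proj_step_nth_zero:
  fixes \<alpha> g :: "real ^ 'm::finite"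
  assumes "\<eta> > 0" "\<alpha> \<in> sparse_proj s (\<alpha> - \<eta> *\<^sub>R g)"
    and "card (insert j {i. \<alpha> $ i \<noteq> 0}) \<le> s"
  shows "g $ j = 0"
proof (rule ccontr)
  assume "g $ j \<noteq> 0"
  let ?u = "\<alpha> - axis j (\<eta> * g $ j)"
  have "l0norm ?u \<le> s"
    by (rule l0norm_le [OF _ assms(3)]) (auto simp: axis_def split: if_splits)
  then have "norm (\<alpha> - (\<alpha> - \<eta> *\<^sub>R g)) \<le> norm (?u - (\<alpha> - \<eta> *\<^sub>R g))"
    using assms(2) by (auto simp: sparse_proj_def is_arg_min_def not_less)
  then have "norm (\<eta> *\<^sub>R g) \<le> norm (\<eta> *\<^sub>R g - axis j (\<eta> * g $ j))"
    by (simp add: algebra_simps)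
  then have "(norm (\<eta> *\<^sub>R g))\<^sup>2 \<le> (norm (\<eta> *\<^sub>R g - axis j (\<eta> * g $ j)))\<^sup>2"
    by (rule power_mono) simp
  moreover have "(norm (\<eta> *\<^sub>R g - axis j (\<eta> * g $ j)))\<^sup>2 = (norm (\<eta> *\<^sub>R g))\<^sup>2 - (\<eta> * g $ j)\<^sup>2"
    unfolding power2_norm_eq_inner
    by (simp add: inner_diff inner_axis inner_axis' power2_eq_square algebra_simps)
  ultimately show False
    using \<open>g $ j \<noteq> 0\<close> assms(1) by simp
qed

text \<open>An exchange argument: a vector with support \<open>S\<close> pays at least the squares
  of \<open>v\<close> outside \<open>S\<close>, and \<alpha> pays exactly those outside its own
  support, which holds \<open>s\<close> entries of \<open>v\<close> of largest magnitude.\<close>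

lemma sparse_projI:
  fixes \<alpha> v :: "real ^ 'm::finite"
  assumes "l0norm \<alpha> = s"
    and eq: "\<And>i. \<alpha> $ i \<noteq> 0 \<Longrightarrow> v $ i = \<alpha> $ i"
    and small: "\<And>i j. \<alpha> $ i \<noteq> 0 \<Longrightarrow> \<alpha> $ j = 0 \<Longrightarrow> \<bar>v $ j\<bar> \<le> \<bar>\<alpha> $ i\<bar>"
  shows "\<alpha> \<in> sparse_proj s v"
proof -
  define T where "T = {i. \<alpha> $ i \<noteq> 0}"
  have "norm (\<alpha> - v) \<le> norm (u - v)" if u: "l0norm u \<le> s" for u
  proof -
    define S where "S = {i. u $ i \<noteq> 0}"
    have cST: "card S \<le> card T"
      using u assms(1) by (simp add: l0norm_def S_def T_def)
    then have diff: "card (S - T) \<le> card (T - S)"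
      by (metis card_le_sym_Diff finite)
    have swap: "(\<Sum>i\<in>S - T. (v $ i)\<^sup>2) \<le> (\<Sum>i\<in>T - S. (v $ i)\<^sup>2)"
    proof -
      \<comment> \<open>Each index of \<open>S - T\<close> is matched with its own index of
        \<open>T - S\<close>, where \<open>v\<close> is at least as large in magnitude by
        \<open>small\<close> and \<open>eq\<close>.\<close>
      obtain f where f: "f ` (S - T) \<subseteq> T - S" "inj_on f (S - T)"
        using card_le_inj [OF _ _ diff] by auto
      have "(\<Sum>i\<in>S - T. (v $ i)\<^sup>2) \<le> (\<Sum>i\<in>S - T. (v $ f i)\<^sup>2)"
      proof (rule sum_mono)
        fix i assume i: "i \<in> S - T"
        then have "\<alpha> $ f i \<noteq> 0" "\<alpha> $ i = 0"
          using f by (auto simp: T_def)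
        then show "(v $ i)\<^sup>2 \<le> (v $ f i)\<^sup>2"
          using small eq by (metis abs_le_square_iff)
      qed
      also have "\<dots> = (\<Sum>i\<in>f ` (S - T). (v $ i)\<^sup>2)"
        using f by (simp add: sum.reindex)
      also have "\<dots> \<le> (\<Sum>i\<in>T - S. (v $ i)\<^sup>2)"
        using f by (intro sum_mono2) auto
      finally show ?thesis .
    qed
    have "(norm (\<alpha> - v))\<^sup>2 = (\<Sum>i\<in>- T. (v $ i)\<^sup>2)"
      unfolding norm_power2_vec
      by (rule sum.mono_neutral_cong_right) (auto simp: T_def eq)
    \<comment> \<open>Both complements contain \<open>- S - T\<close>, so only \<open>S - T\<close>
      and \<open>T - S\<close> have to be compared.\<close>
    also have "- T = (S - T) \<union> (- S - T)"
      by auto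
    also have "(\<Sum>i\<in>(S - T) \<union> (- S - T). (v $ i)\<^sup>2)
        = (\<Sum>i\<in>S - T. (v $ i)\<^sup>2) + (\<Sum>i\<in>- S - T. (v $ i)\<^sup>2)"
      by (rule sum.union_disjoint) auto
    also have "\<dots> \<le> (\<Sum>i\<in>T - S. (v $ i)\<^sup>2) + (\<Sum>i\<in>- S - T. (v $ i)\<^sup>2)"
      using swap by simp
    also have "\<dots> = (\<Sum>i\<in>(T - S) \<union> (- S - T). (v $ i)\<^sup>2)"
      by (rule sum.union_disjoint [symmetric]) auto
    also have "(T - S) \<union> (- S - T) = - S"
      by auto
    also have "(\<Sum>i\<in>- S. (v $ i)\<^sup>2) = (\<Sum>i\<in>- S. ((u - v) $ i)\<^sup>2)"
      by (rule sum.cong) (auto simp: S_def)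
    also have "\<dots> \<le> (norm (u - v))\<^sup>2"
      unfolding norm_power2_vec by (rule sum_mono2) auto
    finally show ?thesis
      by (simp add: power2_le_iff_abs_le)
  qed
  then show ?thesis
    using assms(1) by (force simp: sparse_proj_def is_arg_min_def not_less)
qed

section \<open>From stationarity to minimality\<close>

lemma global_imp_local:
  "global_minimizer x y C c s \<alpha> \<Longrightarrow> local_minimizer x y C c s \<alpha>"
  unfolding global_minimizer_def local_minimizer_def is_arg_min_def
  by (intro exI [of _ 1]) auto

lemma global_minimizerI:
  assumes "feasible y s \<alpha>" "\<And>\<beta>. feasible y s \<beta> \<Longrightarrow> dual_obj x y C c \<alpha> \<le> dual_obj x y C c \<beta>"
  shows "global_minimizer x y C c s \<alpha>"
  using assms by (force simp: global_minimizer_def is_arg_min_def not_less)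

lemma unique_global_minimizerI:
  assumes "feasible y s \<alpha>"
    and less: "\<And>\<beta>. feasible y s \<beta> \<Longrightarrow> \<beta> \<noteq> \<alpha> \<Longrightarrow> dual_obj x y C c \<alpha> < dual_obj x y C c \<beta>"
  shows "unique_global_minimizer x y C c s \<alpha>"
  unfolding unique_global_minimizer_def
proof (intro conjI allI impI)
  show "global_minimizer x y C c s \<alpha>"
    using assms by (metis global_minimizerI order.refl less_imp_le)
  fix \<beta> assume "global_minimizer x y C c s \<beta>"
  then show "\<beta> = \<alpha>"
    using assms unfolding global_minimizer_def is_arg_min_def by blast
qed

text \<open>Without a linear term, the lower bound exceeds the value at \<alpha> by a positive
  multiple of the squared distance.\<close>

lemma gmap_zero_unique_global_minimizer:
  assumes "0 < c" "c < C" "feasible y s \<alpha>" "gmap x y C c (\<alpha>, b) = 0"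
  shows "unique_global_minimizer x y C c s \<alpha>"
proof (rule unique_global_minimizerI [OF assms(3)])
  fix \<beta> assume "feasible y s \<beta>" "\<beta> \<noteq> \<alpha>"
  moreover have "0 < (norm (\<beta> - \<alpha>))\<^sup>2 / (2 * C)"
    using assms \<open>\<beta> \<noteq> \<alpha>\<close> by simp
  ultimately show "dual_obj x y C c \<alpha> < dual_obj x y C c \<beta>"
    using dual_obj_lower_gmap [OF assms(1,2), of \<alpha> y \<beta> x b] assms(3,4)
    by (simp add: feasible_def)
qed

text \<open>Below the sparsity limit any single index may join the support, so the coordinatewise
  argument reaches all of \<open>g\<close>.\<close>

lemma sparse_proj_step_zero:
  fixes \<alpha> g :: "real ^ 'm::finite"
  assumes "\<eta> > 0" "\<alpha> \<in> sparse_proj s (\<alpha> - \<eta> *\<^sub>R g)" "l0norm \<alpha> < s"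
  shows "g = 0"
proof -
  have "card (insert j {i. \<alpha> $ i \<noteq> 0}) \<le> s" for j
    using assms(3) by (simp add: l0norm_def card_insert_if)
  then show ?thesis
    using sparse_proj_step_nth_zero [OF assms(1,2)] by (simp add: vec_eq_iff)
qed

lemma stationary_unique_global_minimizer:
  assumes "0 < c" "c < C" "feasible y s \<alpha>" "l0norm \<alpha> < s" "\<eta> > 0" "eta_stationary x y C c s \<eta> \<alpha>"
  shows "unique_global_minimizer x y C c s \<alpha>"
proof -
  obtain b where "\<alpha> \<in> sparse_proj s (\<alpha> - \<eta> *\<^sub>R gmap x y C c (\<alpha>, b))"
    using assms(6) by (auto simp: eta_stationary_def)
  then show ?thesis
    by (intro gmap_zero_unique_global_minimizer [OF assms(1-3)] sparse_proj_step_zero [OF assms(5) _ assms(4)])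
qed

text \<open>Feasible points close to \<alpha> have the same support \<open>T\<close>. On
  \<open>T\<close> the vector \<open>g\<close> vanishes, and off \<open>T\<close> the displacement
  does, so no linear term remains.\<close>

lemma stationary_full_local_minimizer:
  assumes "0 < c" "c < C" and feas: "feasible y s \<alpha>" and full: "l0norm \<alpha> = s"
    and "\<eta> > 0" "eta_stationary x y C c s \<eta> \<alpha>"
  shows "local_minimizer x y C c s \<alpha>"
proof -
  obtain b where b: "\<alpha> \<in> sparse_proj s (\<alpha> - \<eta> *\<^sub>R gmap x y C c (\<alpha>, b))"
    using assms(6) by (auto simp: eta_stationary_def)
  define T where "T = {i. \<alpha> $ i \<noteq> 0}"
  have gT: "gmap x y C c (\<alpha>, b) $ i = 0" if "i \<in> T" for i
    using that full by (intro sparse_proj_step_nth_zero [OF \<open>\<eta> > 0\<close> b])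
      (simp add: T_def l0norm_def insert_absorb)
  \<comment> \<open>The smallest nonzero magnitude in \<alpha>, capped at 1; the extra element keeps
    \<open>Min\<close> meaningful when \<open>T\<close> is empty.\<close>
  define e where "e = Min (insert 1 ((\<lambda>i. \<bar>\<alpha> $ i\<bar>) ` T))"
  have "e > 0"
    unfolding e_def by (subst Min_gr_iff) (auto simp: T_def)
  have e_le: "e \<le> \<bar>\<alpha> $ i\<bar>" if "i \<in> T" for i
    unfolding e_def using that by (intro Min_le) auto
  have le: "dual_obj x y C c \<alpha> \<le> dual_obj x y C c \<beta>"
    if \<beta>: "feasible y s \<beta>" "dist \<beta> \<alpha> < e" for \<beta>
  proof -
    have "T \<subseteq> {i. \<beta> $ i \<noteq> 0}"
    proof
      fix i assume "i \<in> T"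
      have "\<bar>(\<beta> - \<alpha>) $ i\<bar> \<le> dist \<beta> \<alpha>"
        unfolding dist_norm by (rule component_le_norm_cart)
      then show "i \<in> {i. \<beta> $ i \<noteq> 0}"
        using e_le [OF \<open>i \<in> T\<close>] \<beta>(2) by auto
    qed
    \<comment> \<open>\<open>T\<close> already has \<open>s\<close> elements, so a support
      containing it cannot be larger.\<close>
    then have "{i. \<beta> $ i \<noteq> 0} = T"
      using \<beta>(1) full by (intro card_seteq [symmetric]) (auto simp: feasible_def l0norm_def T_def)
    then have "gmap x y C c (\<alpha>, b) $ i * (\<beta> - \<alpha>) $ i = 0" for i
      using gT [of i] by (cases "i \<in> T") (auto simp: T_def)
    then have "gmap x y C c (\<alpha>, b) \<bullet> (\<beta> - \<alpha>) = 0"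
      unfolding inner_vec_def inner_real_def by (simp only: sum.neutral_const)
    moreover have "0 \<le> (norm (\<beta> - \<alpha>))\<^sup>2 / (2 * C)"
      using assms(1,2) by simp
    ultimately show ?thesis
      using dual_obj_lower_gmap [OF assms(1,2), of \<alpha> y \<beta> x b] feas \<beta>(1)
      by (simp add: feasible_def)
  qed
  then show ?thesis
    unfolding local_minimizer_def is_arg_min_def
    using \<open>e > 0\<close> feas by (intro exI [of _ e]) (auto dest: le)
qed

text \<open>Stationarity lets the linear term fall no lower than minus the squared distance over
  \<open>2 * \<eta>\<close>, while strong convexity adds the squared distance over
  \<open>2 * C\<close>. The net coefficient is nonnegative for \<eta> \<ge> C and positive for
  \<eta> > C.\<close>

lemma stationary_large_step:
  assumes "0 < c" "c < C" "feasible y s \<alpha>" "\<eta> \<ge> C" "eta_stationary x y C c s \<eta> \<alpha>"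
  shows "global_minimizer x y C c s \<alpha>"
    and "\<eta> > C \<Longrightarrow> unique_global_minimizer x y C c s \<alpha>"
proof -
  obtain b where b: "\<alpha> \<in> sparse_proj s (\<alpha> - \<eta> *\<^sub>R gmap x y C c (\<alpha>, b))"
    using assms(5) by (auto simp: eta_stationary_def)
  have "C > 0" "\<eta> > 0"
    using assms by auto
  have key: "dual_obj x y C c \<alpha> + (1 / (2 * C) - 1 / (2 * \<eta>)) * (norm (\<beta> - \<alpha>))\<^sup>2
      \<le> dual_obj x y C c \<beta>" if \<beta>: "feasible y s \<beta>" for \<beta>
  proof -
    let ?g = "gmap x y C c (\<alpha>, b)"
    \<comment> \<open>A feasible \<beta> is sparse enough to compete in the projection.\<close>
    have "norm (\<alpha> - (\<alpha> - \<eta> *\<^sub>R ?g)) \<le> norm (\<beta> - (\<alpha> - \<eta> *\<^sub>R ?g))"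
      using b \<beta> by (auto simp: sparse_proj_def is_arg_min_def feasible_def not_less)
    then have "norm (\<eta> *\<^sub>R ?g) \<le> norm ((\<beta> - \<alpha>) + \<eta> *\<^sub>R ?g)"
      by (simp add: algebra_simps)
    then have "(norm (\<eta> *\<^sub>R ?g))\<^sup>2 \<le> (norm ((\<beta> - \<alpha>) + \<eta> *\<^sub>R ?g))\<^sup>2"
      by (rule power_mono) simp
    also have "\<dots> = (norm (\<beta> - \<alpha>))\<^sup>2 + 2 * \<eta> * (?g \<bullet> (\<beta> - \<alpha>)) + (norm (\<eta> *\<^sub>R ?g))\<^sup>2"
      unfolding power2_norm_eq_inner by (simp add: inner_add inner_commute del: inner_diff_left)
    finally have "0 \<le> ((norm (\<beta> - \<alpha>))\<^sup>2 + 2 * \<eta> * (?g \<bullet> (\<beta> - \<alpha>))) / (2 * \<eta>)"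
      using \<open>\<eta> > 0\<close> by simp
    then have "- ((norm (\<beta> - \<alpha>))\<^sup>2 / (2 * \<eta>)) \<le> ?g \<bullet> (\<beta> - \<alpha>)"
      using \<open>\<eta> > 0\<close> by (simp add: add_divide_distrib)
    then show ?thesis
      using dual_obj_lower_gmap [OF assms(1,2), of \<alpha> y \<beta> x b] assms(3) \<beta>
      by (simp add: feasible_def left_diff_distrib)
  qed
  have "1 / (2 * \<eta>) \<le> 1 / (2 * C)"
    using \<open>C > 0\<close> assms(4) by (simp add: frac_le)
  then have "0 \<le> (1 / (2 * C) - 1 / (2 * \<eta>)) * (norm (\<beta> - \<alpha>))\<^sup>2" for \<beta>
    by simp
  then show "global_minimizer x y C c s \<alpha>"
    using key by (intro global_minimizerI [OF assms(3)]) (smt (verit))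
  assume "\<eta> > C"
  then have "1 / (2 * \<eta>) < 1 / (2 * C)"
    using \<open>C > 0\<close> by (simp add: frac_less2)
  then have "0 < (1 / (2 * C) - 1 / (2 * \<eta>)) * (norm (\<beta> - \<alpha>))\<^sup>2" if "\<beta> \<noteq> \<alpha>" for \<beta>
    using that by simp
  then show "unique_global_minimizer x y C c s \<alpha>"
    using key by (intro unique_global_minimizerI [OF assms(3)]) (smt (verit))
qed

section \<open>From local minimality to stationarity\<close>

lemma zero_if_quadratic_nonneg_near_zero:
  fixes a K e :: real
  assumes "e > 0" "\<And>t. \<bar>t\<bar> < e \<Longrightarrow> 0 \<le> t * a + t\<^sup>2 * K"
  shows "a = 0"
proof -
  have "((\<lambda>t. t * a + t\<^sup>2 * K) has_real_derivative a) (at 0)"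
    by (auto intro!: derivative_eq_intros)
  \<comment> \<open>The polynomial is 0 at \<open>t = 0\<close> and nonnegative on both sides, so 0
    is a local minimum and the derivative \<open>a\<close> vanishes.\<close>
  then show ?thesis
    by (rule DERIV_local_min [OF _ assms(1)]) (use assms(2) in auto)
qed

lemma local_minimizer_grad_pair:
  assumes y: "\<forall>i. y $ i \<in> {-1, 1}" and c: "0 < c" "c < C"
    and min: "local_minimizer x y C c s \<alpha>"
    and supp: "card ({i. \<alpha> $ i \<noteq> 0} \<union> {i, j}) \<le> s"
  shows "y $ i * grad x y C c \<alpha> $ i = y $ j * grad x y C c \<alpha> $ j"
proof -
  \<comment> \<open>Since the labels square to 1, \<open>d\<close> is orthogonal to
    \<open>y\<close>, and moving along it changes only coordinates \<open>i\<close> and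
    \<open>j\<close>.\<close>
  define d where "d = axis i (y $ i) - axis j (y $ j)"
  obtain e where "e > 0"
    and arg: "is_arg_min (dual_obj x y C c) (\<lambda>\<beta>. feasible y s \<beta> \<and> dist \<beta> \<alpha> < e) \<alpha>"
    using min unfolding local_minimizer_def by blast
  then have feas: "feasible y s \<alpha>"
    and e: "\<And>\<beta>. feasible y s \<beta> \<Longrightarrow> dist \<beta> \<alpha> < e \<Longrightarrow> dual_obj x y C c \<alpha> \<le> dual_obj x y C c \<beta>"
    by (auto simp: is_arg_min_def not_less)
  have yy: "y $ k * y $ k = 1" for k
    using y [rule_format, of k] by auto
  then have dy: "d \<bullet> y = 0"
    by (simp add: d_def inner_diff_left inner_axis')
  have "0 \<le> t * (grad x y C c \<alpha> \<bullet> d)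
      + t\<^sup>2 * ((norm (Qmat x y *v d))\<^sup>2 / 2 + (norm d)\<^sup>2 / (2 * c))"
    \<comment> \<open>The summand 1 keeps the denominator positive when \<open>i = j\<close>, where
      \<open>d = 0\<close>, and still yields displacement below \<open>e\<close>.\<close>
    if t: "\<bar>t\<bar> < e / (norm d + 1)" for t
  proof -
    have "l0norm (\<alpha> + t *\<^sub>R d) \<le> s"
      by (rule l0norm_le [OF _ supp]) (auto simp: d_def axis_def)
    then have "feasible y s (\<alpha> + t *\<^sub>R d)"
      using feas dy by (simp add: feasible_def inner_add_left)
    moreover have "\<bar>t\<bar> * (norm d + 1) < e"
      using t by (simp add: pos_less_divide_eq add_nonneg_pos)
    then have "dist (\<alpha> + t *\<^sub>R d) \<alpha> < e"
      by (simp add: dist_norm distrib_left)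
    ultimately show ?thesis
      using e dual_obj_upper [OF c, of x y \<alpha> t d] by fastforce
  qed
  moreover have "e / (norm d + 1) > 0"
    using \<open>e > 0\<close> by (simp add: add_nonneg_pos)
  ultimately have "grad x y C c \<alpha> \<bullet> d = 0"
    using zero_if_quadratic_nonneg_near_zero by blast
  then show ?thesis
    by (simp add: d_def inner_diff_right inner_axis mult.commute)
qed

text \<open>The common value of the signed partial derivatives, negated, serves as multiplier
  \<open>b\<close>: it cancels coordinate \<open>j\<close> because \<open>y $ j\<close> squares to
  1.\<close>

lemma gmap_nth_zero:
  assumes "\<forall>i. y $ i \<in> {-1, 1}" "y $ i * grad x y C c \<alpha> $ i = y $ j * grad x y C c \<alpha> $ j"
  shows "gmap x y C c (\<alpha>, - (y $ i * grad x y C c \<alpha> $ i)) $ j = 0"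
  using assms(1) [rule_format, of j] unfolding gmap_eq assms(2) by auto

text \<open>A single nonzero entry \<open>\<alpha> $ k\<close> would contribute
  \<open>\<alpha> $ k * y $ k\<close> to the inner product with nothing to cancel it.\<close>

lemma feasible_one_zero:
  assumes y: "\<forall>i. y $ i \<in> {-1, 1}" and "feasible y 1 \<alpha>"
  shows "\<alpha> = 0"
proof (rule ccontr)
  assume "\<alpha> \<noteq> 0"
  then obtain k where k: "\<alpha> $ k \<noteq> 0"
    by (auto simp: vec_eq_iff)
  have only: "\<alpha> $ i = 0" if "i \<noteq> k" for i
  proof (rule ccontr)
    assume "\<alpha> $ i \<noteq> 0"
    then have "card {i, k} \<le> card {i. \<alpha> $ i \<noteq> 0}"
      using k by (intro card_mono) auto
    then show False
      using assms(2) that by (simp add: feasible_def l0norm_def)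
  qed
  then have "\<alpha> = axis k (\<alpha> $ k)"
    by (auto simp: vec_eq_iff axis_def)
  then have "\<alpha> \<bullet> y = axis k (\<alpha> $ k) \<bullet> y"
    by simp
  then have "\<alpha> \<bullet> y = \<alpha> $ k * y $ k"
    unfolding inner_axis' inner_real_def .
  then show False
    using assms(2) k y [rule_format, of k] by (auto simp: feasible_def)
qed

lemma grad_zero: "grad x y C c 0 = - vec 1"
  by (simp add: grad_def)

lemma local_minimizer_gmap_zero:
  fixes y :: "real ^ 'm::finite"
  assumes y: "\<forall>i. y $ i \<in> {-1, 1}" and c: "0 < c" "c < C"
    and min: "local_minimizer x y C c s \<alpha>" and less: "l0norm \<alpha> < s" and nd: "nondegenerate y s"
  shows "\<exists>b. gmap x y C c (\<alpha>, b) = 0"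
proof -
  have "\<exists>i. \<forall>j. y $ i * grad x y C c \<alpha> $ i = y $ j * grad x y C c \<alpha> $ j"
  proof (cases "\<alpha> = 0")
    case False
    then obtain i where i: "\<alpha> $ i \<noteq> 0"
      by (auto simp: vec_eq_iff)
    \<comment> \<open>With \<open>i\<close> fixed in the support, only \<open>j\<close> can be new,
      and there is room for one more index.\<close>
    have "card ({i. \<alpha> $ i \<noteq> 0} \<union> {i, j}) \<le> s" for j
    proof -
      have "{i. \<alpha> $ i \<noteq> 0} \<union> {i, j} = insert j {i. \<alpha> $ i \<noteq> 0}"
        using i by auto
      then show ?thesis
        using less by (simp add: l0norm_def card_insert_if)
    qed
    then show ?thesis
      using local_minimizer_grad_pair [OF y c min] by blast
  next
    case True
    show ?thesis
    proof (cases "s = 1")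
      case True
      \<comment> \<open>The gradient at 0 is \<open>- vec 1\<close>, so equal labels already give
        equal signed partial derivatives.\<close>
      then show ?thesis
        using nd \<open>\<alpha> = 0\<close> by (simp add: nondegenerate_def grad_zero)
    next
      case False
      \<comment> \<open>Here \<open>s\<close> is at least 2, leaving room for both indices when the
        support is empty.\<close>
      then have "card ({i. \<alpha> $ i \<noteq> 0} \<union> {i, j}) \<le> s" for i j :: 'm
        using less \<open>\<alpha> = 0\<close> by (simp add: card_insert_if)
      then show ?thesis
        using local_minimizer_grad_pair [OF y c min] by blast
    qed
  qed
  then show ?thesis
    using gmap_nth_zero [OF y] unfolding vec_eq_iff zero_index by blast
qed

lemma gmap_zero_stationary:
  assumes "feasible y s \<alpha>" "gmap x y C c (\<alpha>, b) = 0"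
  shows "eta_stationary x y C c s \<eta> \<alpha>"
  unfolding eta_stationary_def
  using assms by (intro exI [of _ b]) (auto simp: feasible_def sparse_proj_def is_arg_min_def)

text \<open>Pairs inside the support need no extra room, so one multiplier makes \<open>g\<close>
  vanish there. Off the support \<open>g\<close> may be nonzero, and \<eta> must be small enough
  that no such entry of the gradient step exceeds the smallest nonzero entry of \<alpha> in
  magnitude.\<close>

lemma local_minimizer_full_stationary:
  assumes y: "\<forall>i. y $ i \<in> {-1, 1}" and c: "0 < c" "c < C" and "s \<ge> 1"
    and min: "local_minimizer x y C c s \<alpha>" and full: "l0norm \<alpha> = s"
  shows "\<exists>\<eta>\<^sub>0>0. \<forall>\<eta>. 0 < \<eta> \<and> \<eta> \<le> \<eta>\<^sub>0 \<longrightarrow> eta_stationary x y C c s \<eta> \<alpha>"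
proof -
  define T where "T = {i. \<alpha> $ i \<noteq> 0}"
  have cT: "card T = s"
    using full by (simp add: l0norm_def T_def)
  then obtain i where "i \<in> T"
    using \<open>s \<ge> 1\<close> by fastforce
  define g where "g = gmap x y C c (\<alpha>, - (y $ i * grad x y C c \<alpha> $ i))"
  have gT: "g $ j = 0" if "j \<in> T" for j
  proof -
    have "T \<union> {i, j} = T"
      using that \<open>i \<in> T\<close> by auto
    then show ?thesis
      unfolding g_def using cT
      by (intro gmap_nth_zero [OF y] local_minimizer_grad_pair [OF y c min]) (simp add: T_def)
  qed
  define e where "e = Min ((\<lambda>i. \<bar>\<alpha> $ i\<bar>) ` T)"
  have "e > 0"
    unfolding e_def using \<open>i \<in> T\<close> by (subst Min_gr_iff) (auto simp: T_def)
  have e_le: "e \<le> \<bar>\<alpha> $ i\<bar>" if "i \<in> T" for i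
    unfolding e_def using that by (intro Min_le) auto
  have "\<alpha> \<bullet> y = 0"
    using min by (auto simp: local_minimizer_def is_arg_min_def feasible_def)
  have "eta_stationary x y C c s \<eta> \<alpha>" if \<eta>: "0 < \<eta>" "\<eta> \<le> e / (norm g + 1)" for \<eta>
  proof -
    have "\<eta> * (norm g + 1) \<le> e"
      using \<eta> by (simp add: pos_le_divide_eq add_nonneg_pos)
    moreover have "\<eta> * \<bar>g $ j\<bar> \<le> \<eta> * (norm g + 1)" for j
      using \<eta> component_le_norm_cart [of g j] by (intro mult_left_mono) auto
    ultimately have "\<eta> * \<bar>g $ j\<bar> \<le> e" for j
      by (meson order_trans)
    then have "\<alpha> \<in> sparse_proj s (\<alpha> - \<eta> *\<^sub>R g)"
      using gT e_le \<eta>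
      by (intro sparse_projI full) (auto simp: T_def abs_mult intro: order_trans)
    then show ?thesis
      using \<open>\<alpha> \<bullet> y = 0\<close> unfolding eta_stationary_def g_def by blast
  qed
  moreover have "e / (norm g + 1) > 0"
    using \<open>e > 0\<close> by (simp add: add_nonneg_pos)
  ultimately show ?thesis
    by blast
qed

lemma local_minimizer_unique_global_minimizer:
  assumes y: "\<forall>i. y $ i \<in> {-1, 1}" and c: "0 < c" "c < C"
    and min: "local_minimizer x y C c s \<alpha>" and less: "l0norm \<alpha> < s"
  shows "unique_global_minimizer x y C c s \<alpha>"
proof -
  have feas: "feasible y s \<alpha>"
    using min by (auto simp: local_minimizer_def is_arg_min_def)
  show ?thesis
  proof (cases "s = 1")
    \<comment> \<open>The feasible set is then just {0}. For any other \<open>s\<close>,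
      \<open>nondegenerate y s\<close> holds vacuously and a multiplier making \<open>gmap\<close>
      vanish exists.\<close>
    case True
    then show ?thesis
      using feas feasible_one_zero [OF y] by (metis unique_global_minimizerI)
  next
    case False
    then show ?thesis
      using local_minimizer_gmap_zero [OF y c min less] gmap_zero_unique_global_minimizer [OF c feas]
      by (auto simp: nondegenerate_def)
  qed
qed

section \<open>Relations between stationary points, local and global minimizers\<close>

theorem theorem2p4:
  fixes x :: "'m::finite \<Rightarrow> real ^ 'n" and y \<alpha> :: "real ^ 'm"
    and c C :: real and s :: nat
  assumes "\<forall>i. y $ i \<in> {-1, 1}"
    and "0 < c" and "c < C"
    and "s \<in> {1..CARD('m)}"
    and "feasible y s \<alpha>"
  shows
    "((\<exists>\<eta>>0. eta_stationary x y C c s \<eta> \<alpha>) \<longrightarrow> local_minimizer x y C c s \<alpha>) \<and>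
    (local_minimizer x y C c s \<alpha> \<longrightarrow>
       (l0norm \<alpha> < s \<and> nondegenerate y s \<longrightarrow> (\<forall>\<eta>>0. eta_stationary x y C c s \<eta> \<alpha>)) \<and>
       (l0norm \<alpha> = s \<longrightarrow> (\<exists>\<eta>\<^sub>0>0. \<forall>\<eta>. 0 < \<eta> \<and> \<eta> \<le> \<eta>\<^sub>0 \<longrightarrow> eta_stationary x y C c s \<eta> \<alpha>))) \<and>
    (l0norm \<alpha> < s \<longrightarrow>
       (local_minimizer x y C c s \<alpha> \<longleftrightarrow> global_minimizer x y C c s \<alpha>) \<and>
       (nondegenerate y s \<longrightarrow>
          (\<forall>\<eta>>0. eta_stationary x y C c s \<eta> \<alpha> \<longleftrightarrow> global_minimizer x y C c s \<alpha>)) \<and>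
       (global_minimizer x y C c s \<alpha> \<longrightarrow> unique_global_minimizer x y C c s \<alpha>)) \<and>
    (l0norm \<alpha> = s \<longrightarrow>
       (\<forall>\<eta>. eta_stationary x y C c s \<eta> \<alpha> \<longrightarrow>
          (\<eta> \<ge> C \<longrightarrow> global_minimizer x y C c s \<alpha>) \<and>
          (\<eta> > C \<longrightarrow> unique_global_minimizer x y C c s \<alpha>)))"
proof -
  note y = assms(1) and c = assms(2,3) and feas = assms(5)
  have s: "s \<ge> 1"
    using assms(4) by simp
  have l0: "l0norm \<alpha> < s \<or> l0norm \<alpha> = s"
    using feas by (auto simp: feasible_def)
  have uniq_global: "global_minimizer x y C c s \<alpha>" if "unique_global_minimizer x y C c s \<alpha>"
    using that by (simp add: unique_global_minimizer_def)
  have stat: "eta_stationary x y C c s \<eta> \<alpha>"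
    if "local_minimizer x y C c s \<alpha>" "l0norm \<alpha> < s" "nondegenerate y s" for \<eta>
    using local_minimizer_gmap_zero [OF y c that] gmap_zero_stationary [OF feas] by blast
  have uniq: "unique_global_minimizer x y C c s \<alpha>"
    if "eta_stationary x y C c s \<eta> \<alpha>" "l0norm \<alpha> < s" "\<eta> > 0" for \<eta>
    using that stationary_unique_global_minimizer [OF c feas] by blast
  \<comment> \<open>Below the sparsity limit the point is even a global minimizer; at the limit the
    common-support argument applies.\<close>
  have a: "local_minimizer x y C c s \<alpha>" if "eta_stationary x y C c s \<eta> \<alpha>" "\<eta> > 0" for \<eta>
    using l0 that uniq uniq_global global_imp_local stationary_full_local_minimizer [OF c feas]
    by blast
  show ?thesis
  proof (intro conjI impI allI)
    assume "\<exists>\<eta>>0. eta_stationary x y C c s \<eta> \<alpha>"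
    then show "local_minimizer x y C c s \<alpha>"
      using a by blast
  next
    fix \<eta> :: real
    assume "local_minimizer x y C c s \<alpha>" "l0norm \<alpha> < s \<and> nondegenerate y s"
    then show "eta_stationary x y C c s \<eta> \<alpha>"
      using stat by blast
  next
    assume "local_minimizer x y C c s \<alpha>" "l0norm \<alpha> = s"
    then show "\<exists>\<eta>\<^sub>0>0. \<forall>\<eta>. 0 < \<eta> \<and> \<eta> \<le> \<eta>\<^sub>0 \<longrightarrow> eta_stationary x y C c s \<eta> \<alpha>"
      using local_minimizer_full_stationary [OF y c s] by blast
  next
    assume less: "l0norm \<alpha> < s"
    show "local_minimizer x y C c s \<alpha> \<longleftrightarrow> global_minimizer x y C c s \<alpha>"
      using local_minimizer_unique_global_minimizer [OF y c _ less] uniq_global global_imp_local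
      by blast
    show "unique_global_minimizer x y C c s \<alpha>" if "global_minimizer x y C c s \<alpha>"
      using local_minimizer_unique_global_minimizer [OF y c _ less] global_imp_local that by blast
    show "eta_stationary x y C c s \<eta> \<alpha> \<longleftrightarrow> global_minimizer x y C c s \<alpha>"
      if "nondegenerate y s" "\<eta> > 0" for \<eta>
      using that less stat uniq uniq_global global_imp_local by blast
  next
    fix \<eta> assume "eta_stationary x y C c s \<eta> \<alpha>"
    then show "global_minimizer x y C c s \<alpha>" if "\<eta> \<ge> C"
      using stationary_large_step(1) [OF c feas] that by blast
    show "unique_global_minimizer x y C c s \<alpha>" if "\<eta> > C"
      using stationary_large_step(2) [OF c feas] that \<open>eta_stationary x y C c s \<eta> \<alpha>\<close> by simp
  qed
qed

end
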